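(* Let $V$ be a nonzero finite-dimensional vector space over a field, let $A : V \to V$ be a nilpotent linear transformation, and let $n$ be the smallest positive integer such that $A^n = 0$. For $i = 0,1,\dots,n$ put $$d_i = \dim N\big(A|_{R(A^i)}\big),$$ the dimension of the null space of the restriction of $A$ to the range $R(A^i)$ of $A^i$. Then the differences $d_0 - d_1,\ d_1 - d_2,\ \dots,\ d_{n-1} - d_n$ give the number of Jordan blocks of $A$ of sizes $1,2,\dots,n$ respectively. That is, in any decomposition of $V$ as a direct sum of cyclic subspaces with respect to $A$, for each $i = 1,\dots,n$ the number of summands of dimension $i$ is exactly $d_{i-1} - d_i$.
   Context: For a linear map $B$, $R(B)$ denotes its range and $N(B)$ its null space; $A^0$ is the identity, so $R(A^0) = V$. Each $R(A^i)$ is $A$-invariant, so $A|_{R(A^i)}$ is a linear map $R(A^i) \to R(A^i)$. A cyclic subspace of $V$ (with respect to the nilpotent map $A$) is an $A$-invariant subspace spanned by $v, Av, \dots, A^{m-1}v$ for some nonzero $v \in V$, where $m$ is the smallest positive integer with $A^m v = 0$; its dimension is $m$. The Jordan blocks of $A$ are the summands in a decomposition of $V$ as a direct sum of cyclic subspaces, and the size of a block is its dimension. *)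

theory Defs
  imports Complex_Main "HOL-Library.FuncSet"
begin

definition nilpotent_map :: "('b::ab_group_add \<Rightarrow> 'b) \<Rightarrow> bool" where
  "nilpotent_map A \<longleftrightarrow> (\<exists>k>0. A ^^ k = (\<lambda>_. 0))"

text \<open>For a map that is not nilpotent, \<^term>\<open>nilpotency_index\<close> is unspecified.\<close>

definition nilpotency_index :: "('b::ab_group_add \<Rightarrow> 'b) \<Rightarrow> nat" where
  "nilpotency_index A = (LEAST k. 0 < k \<and> A ^^ k = (\<lambda>_. 0))"

text \<open>Restricting \<open>A\<close> to \<open>U\<close> keeps the underlying function; only the domain changes.\<close>

definition null_space_on :: "'b set \<Rightarrow> ('b::ab_group_add \<Rightarrow> 'b) \<Rightarrow> 'b set" where
  "null_space_on U A = {u \<in> U. A u = 0}"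

definition cyclic_subspace ::
    "('a::field \<Rightarrow> 'b::ab_group_add \<Rightarrow> 'b) \<Rightarrow> ('b \<Rightarrow> 'b) \<Rightarrow> 'b set \<Rightarrow> bool" where
  "cyclic_subspace scale A W \<longleftrightarrow>
     module.subspace scale W \<and> A ` W \<subseteq> W \<and>
     (\<exists>v m. v \<noteq> 0 \<and>
            0 < m \<and> (A ^^ m) v = 0 \<and> (\<forall>k. 0 < k \<and> k < m \<longrightarrow> (A ^^ k) v \<noteq> 0) \<and>
            W = module.span scale ((\<lambda>j. (A ^^ j) v) ` {..<m}))"

text \<open>The whole space is the internal direct sum of the finite family \<open>W\<close> over \<open>I\<close>.
  The extensional product \<open>Pi\<^sub>E\<close> is used so that uniqueness concerns only the
  components with index in \<open>I\<close>.\<close>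

definition is_direct_sum ::
    "('a::field \<Rightarrow> 'b::ab_group_add \<Rightarrow> 'b) \<Rightarrow> 'i set \<Rightarrow> ('i \<Rightarrow> 'b set) \<Rightarrow> bool" where
  "is_direct_sum scale I W \<longleftrightarrow>
     finite I \<and> (\<forall>j\<in>I. module.subspace scale (W j)) \<and>
     (\<forall>v. \<exists>!w. w \<in> Pi\<^sub>E I W \<and> v = (\<Sum>j\<in>I. w j))"

definition cyclic_decomposition ::
    "('a::field \<Rightarrow> 'b::ab_group_add \<Rightarrow> 'b) \<Rightarrow> ('b \<Rightarrow> 'b) \<Rightarrow> 'i set \<Rightarrow> ('i \<Rightarrow> 'b set) \<Rightarrow> bool" where
  "cyclic_decomposition scale A I W \<longleftrightarrow>
     is_direct_sum scale I W \<and> (\<forall>j\<in>I. cyclic_subspace scale A (W j))"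

end

theory Submission
  imports Defs
begin

text \<open>
  A cyclic summand \<open>W\<^sub>j\<close> generated by \<open>v\<^sub>j\<close> with basis \<open>v\<^sub>j, A v\<^sub>j, \<dots>, A\<^bsup>m-1\<^esup> v\<^sub>j\<close>
  (\<open>m = m\<^sub>j\<close>) meets the null space of \<open>A\<close> only in the line through the last vector
  \<open>u\<^sub>j = A\<^bsup>m-1\<^esup> v\<^sub>j\<close> of the chain (\<open>cyclic_kernel\<close>). That line lies in the range of
  \<open>A\<^sup>i\<close> when \<open>i < m\<^sub>j\<close>, whereas \<open>A\<^sup>i\<close> annihilates \<open>W\<^sub>j\<close> when \<open>i \<ge> m\<^sub>j\<close>. Because both the
  range of \<open>A\<^sup>i\<close> and the condition \<open>A x = 0\<close> can be examined summand by summand, the null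
  space of \<open>A\<close> restricted to the range of \<open>A\<^sup>i\<close> has the basis of all \<open>u\<^sub>j\<close> with \<open>m\<^sub>j > i\<close>
  (\<open>kernel_on_range\<close>). Hence \<open>d\<^sub>i\<close> counts the blocks of size greater than \<open>i\<close>, and
  \<open>d\<^bsub>i-1\<^esub> - d\<^sub>i\<close> counts those of size exactly \<open>i\<close>.
\<close>

section \<open>Direct sums and independent families\<close>

lemma direct_sum_components:
  assumes "is_direct_sum scale I W"
  obtains w where "\<And>j. j \<in> I \<Longrightarrow> w j \<in> W j" and "x = (\<Sum>j\<in>I. w j)"
proof -
  have "\<exists>!w. w \<in> Pi\<^sub>E I W \<and> x = (\<Sum>j\<in>I. w j)"
    using assms unfolding is_direct_sum_def by blast
  then obtain w where "w \<in> Pi\<^sub>E I W" "x = (\<Sum>j\<in>I. w j)" by blast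
  then show thesis by (intro that[of w]) auto
qed

context vector_space
begin

lemma direct_sum_zero:
  assumes ds: "is_direct_sum scale I W"
    and w: "\<And>j. j \<in> I \<Longrightarrow> w j \<in> W j" and sum0: "(\<Sum>j\<in>I. w j) = 0" and j: "j \<in> I"
  shows "w j = 0"
proof -
  have ex1: "\<exists>!w. w \<in> Pi\<^sub>E I W \<and> 0 = (\<Sum>j\<in>I. w j)"
    using ds unfolding is_direct_sum_def by blast
  have sub: "\<And>j. j \<in> I \<Longrightarrow> 0 \<in> W j"
    using ds subspace_0 unfolding is_direct_sum_def by blast
  have "restrict w I \<in> Pi\<^sub>E I W \<and> 0 = (\<Sum>j\<in>I. restrict w I j)"
    using w sum0 by auto
  moreover have "restrict (\<lambda>_. 0) I \<in> Pi\<^sub>E I W \<and> 0 = (\<Sum>j\<in>I. restrict (\<lambda>_. 0) I j)"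
    using sub by auto
  ultimately have "restrict w I = restrict (\<lambda>_. 0) I" using ex1 by blast
  then have "restrict w I j = restrict (\<lambda>_. 0) I j" by simp
  then show ?thesis using j by simp
qed

text \<open>Stating independence for an indexed family makes injectivity of the indexing part of
  the conclusion, so that dimensions can be read off as numbers of indices.\<close>

lemma independent_family:
  assumes fin: "finite J"
    and triv: "\<And>c. (\<Sum>j\<in>J. c j *s b j) = 0 \<Longrightarrow> \<forall>j\<in>J. c j = 0"
  shows "inj_on b J" and "independent (b ` J)"
proof -
  show inj: "inj_on b J"
  proof (rule inj_onI, rule ccontr)
    fix j k assume jk: "j \<in> J" "k \<in> J" "b j = b k" "j \<noteq> k"
    let ?c = "\<lambda>l. if l = j then 1 else if l = k then - 1 else (0::'a)"
    have "(\<Sum>l\<in>J. ?c l *s b l) = (\<Sum>l\<in>{j,k}. ?c l *s b l)"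
      using fin jk by (intro sum.mono_neutral_right) auto
    also have "\<dots> = 0" using jk by simp
    finally have "?c j = 0" using triv[of ?c] jk by blast
    then show False by simp
  qed
  show "independent (b ` J)"
  proof (rule independent_if_scalars_zero)
    show "finite (b ` J)" using fin by simp
  next
    fix f x assume "(\<Sum>x\<in>b ` J. f x *s x) = 0" and x: "x \<in> b ` J"
    then have "(\<Sum>j\<in>J. f (b j) *s b j) = 0" by (simp add: sum.reindex[OF inj])
    then show "f x = 0" using triv[of "\<lambda>j. f (b j)"] x by blast
  qed
qed

lemma dim_span_family:
  assumes "finite J" and "\<And>c. (\<Sum>j\<in>J. c j *s b j) = 0 \<Longrightarrow> \<forall>j\<in>J. c j = 0"
  shows "dim (span (b ` J)) = card J"
  using independent_family[OF assms] dim_span_eq_card_independent card_image by metis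

lemma span_family_coefficients:
  assumes fin: "finite J" and inj: "inj_on b J" and x: "x \<in> span (b ` J)"
  obtains c where "x = (\<Sum>j\<in>J. c j *s b j)"
proof -
  obtain f where "x = (\<Sum>y\<in>b ` J. f y *s y)"
    using x fin by (auto simp: span_finite)
  then have "x = (\<Sum>j\<in>J. f (b j) *s b j)" by (simp add: sum.reindex[OF inj])
  then show thesis by (rule that)
qed

end

section \<open>A single cyclic subspace\<close>

locale endomorphism = vector_space scale
  for scale :: "'a::field \<Rightarrow> 'b::ab_group_add \<Rightarrow> 'b" (infixr \<open>*s\<close> 75) +
  fixes A :: "'b \<Rightarrow> 'b"
  assumes lin: "Vector_Spaces.linear scale scale A"
begin

lemma linear_power: "Vector_Spaces.linear scale scale (A ^^ k)"
proof (induction k)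
  case 0
  show ?case using linear_id by (simp add: id_def)
next
  case (Suc k)
  show ?case using Vector_Spaces.linear_compose[OF Suc lin] by (simp only: funpow.simps)
qed

lemma hom_A: "module_hom scale scale A"
  using lin by (rule Vector_Spaces.linear.axioms)

lemma hom_power: "module_hom scale scale (A ^^ k)"
  using linear_power by (rule Vector_Spaces.linear.axioms)

lemma power_eq_0_mono: "(A ^^ m) v = 0 \<Longrightarrow> m \<le> k \<Longrightarrow> (A ^^ k) v = 0"
  using module_hom.zero[OF hom_power] by (metis funpow_add le_add_diff_inverse2 comp_apply)

lemma power_sum: "(A ^^ k) (\<Sum>j\<in>J. f j) = (\<Sum>j\<in>J. (A ^^ k) (f j))"
  by (rule module_hom.sum[OF hom_power])

text \<open>If all coefficients before \<open>c k\<close> vanish, applying \<open>A\<^bsup>m-1-k\<^esup>\<close> to the relation kills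
  every later term and leaves \<open>c k\<close> times the nonzero last vector of the chain.\<close>

lemma chain_coefficients_zero:
  assumes top: "(A ^^ m) v = 0" and last: "(A ^^ (m - 1)) v \<noteq> 0"
    and rel: "(\<Sum>k<m. c k *s (A ^^ k) v) = 0"
  shows "\<forall>k\<in>{..<m}. c k = 0"
proof -
  have "k < m \<Longrightarrow> c k = 0" for k
  proof (induction k rule: less_induct)
    case (less k)
    let ?r = "m - 1 - k"
    have "0 = (A ^^ ?r) (\<Sum>l<m. c l *s (A ^^ l) v)"
      by (simp add: rel module_hom.zero[OF hom_power])
    also have "\<dots> = (\<Sum>l<m. c l *s (A ^^ (?r + l)) v)"
      by (simp add: power_sum module_hom.scale[OF hom_power] funpow_add)
    also have "\<dots> = (\<Sum>l\<in>{k}. c l *s (A ^^ (?r + l)) v)"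
    proof (rule sum.mono_neutral_right)
      show "\<forall>l\<in>{..<m} - {k}. c l *s (A ^^ (?r + l)) v = 0"
      proof
        fix l assume "l \<in> {..<m} - {k}"
        then consider "l < k" | "m \<le> ?r + l" by fastforce
        then show "c l *s (A ^^ (?r + l)) v = 0"
          using less power_eq_0_mono[OF top] by cases auto
      qed
    qed (use less.prems in auto)
    also have "\<dots> = c k *s (A ^^ (m - 1)) v" using less.prems by simp
    finally show ?case using last by simp
  qed
  then show ?thesis by simp
qed

lemma cyclic_dim:
  assumes "(A ^^ m) v = 0" and "(A ^^ (m - 1)) v \<noteq> 0"
  shows "dim (span ((\<lambda>k. (A ^^ k) v) ` {..<m})) = m"
  using dim_span_family[of "{..<m}" "\<lambda>k. (A ^^ k) v"] chain_coefficients_zero[OF assms] by simp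

text \<open>Applying \<open>A\<close> shifts the chain by one step, so a linear combination in the kernel is
  again a relation on the chain unless only its last coefficient is nonzero.\<close>

lemma cyclic_kernel:
  assumes m: "0 < m" and top: "(A ^^ m) v = 0" and last: "(A ^^ (m - 1)) v \<noteq> 0"
    and y: "y \<in> span ((\<lambda>k. (A ^^ k) v) ` {..<m})" and Ay: "A y = 0"
  obtains a where "y = a *s (A ^^ (m - 1)) v"
proof -
  have "inj_on (\<lambda>k. (A ^^ k) v) {..<m}"
    using chain_coefficients_zero[OF top last] by (intro independent_family(1)) auto
  then obtain c where c: "y = (\<Sum>k<m. c k *s (A ^^ k) v)"
    using span_family_coefficients[OF _ _ y] by auto
  obtain p where p: "m = Suc p" using m gr0_implies_Suc by blast
  \<comment> \<open>\<open>A y\<close> has no component along the generator \<open>v\<close> itself, hence the \<open>0\<close>.\<close>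
  define c' where "c' k = (case k of 0 \<Rightarrow> 0 | Suc l \<Rightarrow> c l)" for k
  have "0 = (\<Sum>k<m. c k *s (A ^^ Suc k) v)"
    using Ay by (simp add: c module_hom.sum[OF hom_A] module_hom.scale[OF hom_A])
  also have "\<dots> = (\<Sum>k<p. c k *s (A ^^ Suc k) v)"
    using top p by simp
  also have "\<dots> = (\<Sum>k<m. c' k *s (A ^^ k) v)"
    unfolding p sum.lessThan_Suc_shift by (simp add: c'_def)
  finally have "\<forall>k\<in>{..<m}. c' k = 0"
    using chain_coefficients_zero[OF top last, of c'] by simp
  then have "c k = 0" if "k < p" for k
    using that p by (auto simp: c'_def dest: bspec[of _ _ "Suc k"])
  then have "y = c p *s (A ^^ (m - 1)) v" by (simp add: c p)
  then show thesis by (rule that)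
qed

lemma cyclic_subspace_obtain:
  assumes "cyclic_subspace scale A U"
  obtains v m where "0 < m" "(A ^^ m) v = 0" "(A ^^ (m - 1)) v \<noteq> 0"
    "U = span ((\<lambda>k. (A ^^ k) v) ` {..<m})"
proof -
  obtain v m where vm: "v \<noteq> 0" "0 < m" "(A ^^ m) v = 0"
      "\<forall>k. 0 < k \<and> k < m \<longrightarrow> (A ^^ k) v \<noteq> 0" "U = span ((\<lambda>k. (A ^^ k) v) ` {..<m})"
    using assms unfolding cyclic_subspace_def by blast
  have "(A ^^ (m - 1)) v \<noteq> 0"
    using vm by (cases "m = 1") auto
  with vm that show thesis by blast
qed

end

section \<open>Null spaces on ranges for a sum of cyclic subspaces\<close>

text \<open>Generators are chosen once for all summands, so that the last chain vectors form an
  indexed family.\<close>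

locale cyclic_sum = endomorphism scale A
  for scale :: "'a::field \<Rightarrow> 'b::ab_group_add \<Rightarrow> 'b" (infixr \<open>*s\<close> 75) and A :: "'b \<Rightarrow> 'b" +
  fixes I :: "'i set" and W :: "'i \<Rightarrow> 'b set" and v :: "'i \<Rightarrow> 'b" and m :: "'i \<Rightarrow> nat"
  assumes direct: "is_direct_sum scale I W"
    and m_pos: "j \<in> I \<Longrightarrow> 0 < m j"
    and top: "j \<in> I \<Longrightarrow> (A ^^ m j) (v j) = 0"
    and last: "j \<in> I \<Longrightarrow> (A ^^ (m j - 1)) (v j) \<noteq> 0"
    and W_eq: "j \<in> I \<Longrightarrow> W j = span ((\<lambda>k. (A ^^ k) (v j)) ` {..<m j})"
begin

abbreviation u :: "'i \<Rightarrow> 'b" where "u j \<equiv> (A ^^ (m j - 1)) (v j)"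

lemma finite_I: "finite I"
  using direct by (simp add: is_direct_sum_def)

lemma subspace_W: "j \<in> I \<Longrightarrow> subspace (W j)"
  by (simp add: W_eq)

lemma dim_W: "j \<in> I \<Longrightarrow> dim (W j) = m j"
  using cyclic_dim[OF top last] by (simp only: W_eq)

lemma u_in_W: "j \<in> I \<Longrightarrow> u j \<in> W j"
  using m_pos by (auto simp: W_eq intro!: span_base)

lemma A_power_chain:
  assumes "j \<in> I" shows "(A ^^ k) (v j) \<in> W j"
proof (cases "k < m j")
  case True
  then show ?thesis using assms by (auto simp: W_eq intro!: span_base)
next
  case False
  then show ?thesis using assms power_eq_0_mono[OF top] by (simp add: W_eq span_zero)
qed

text \<open>Both the invariance of \<open>W j\<close> under powers of \<open>A\<close> and its annihilation by high powers
  need checking on the chain only; they are the cases \<open>S = W j\<close> and \<open>S = {0}\<close>.\<close>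

lemma power_span_chain:
  assumes j: "j \<in> I" and y: "y \<in> W j"
    and sub: "subspace S" and gen: "\<And>k. (A ^^ (i + k)) (v j) \<in> S"
  shows "(A ^^ i) y \<in> S"
proof -
  have "(A ^^ i) ` span ((\<lambda>k. (A ^^ k) (v j)) ` {..<m j})
      = span ((A ^^ i) ` (\<lambda>k. (A ^^ k) (v j)) ` {..<m j})"
    by (rule module_hom.span_image[OF hom_power, symmetric])
  also have "\<dots> \<subseteq> S"
    using gen by (intro span_minimal sub) (auto simp: funpow_add)
  finally show ?thesis using y j by (auto simp: W_eq)
qed

lemma power_in_W: "j \<in> I \<Longrightarrow> y \<in> W j \<Longrightarrow> (A ^^ i) y \<in> W j"
  by (rule power_span_chain) (auto simp: subspace_W A_power_chain)

lemma power_annihilates_W: "j \<in> I \<Longrightarrow> y \<in> W j \<Longrightarrow> m j \<le> i \<Longrightarrow> (A ^^ i) y = 0"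
  using power_span_chain[of j y "{0}" i] power_eq_0_mono[OF top] by auto

text \<open>The terms of such a relation lie in distinct summands, so each of them vanishes.\<close>

lemma last_vectors_independent:
  assumes J: "J \<subseteq> I" and rel: "(\<Sum>j\<in>J. c j *s u j) = 0"
  shows "\<forall>j\<in>J. c j = 0"
proof
  fix j assume j: "j \<in> J"
  let ?w = "\<lambda>l. if l \<in> J then c l *s u l else 0"
  have "(\<Sum>l\<in>I. ?w l) = 0"
    using rel J finite_I by (simp add: sum.inter_restrict[symmetric] Int_absorb1)
  moreover have "?w l \<in> W l" if "l \<in> I" for l
    using that subspace_W subspace_0 subspace_scale u_in_W by auto
  ultimately have "?w j = 0"
    using direct_sum_zero[OF direct, of ?w j] j J by blast
  then show "c j = 0" using j J last by auto
qed

text \<open>For \<open>x = A\<^sup>i y\<close> with \<open>A x = 0\<close>, directness of the sum forces \<open>A\<^sup>i\<close> of every component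
  of \<open>y\<close> into the null space; each of these is then a multiple of \<open>u j\<close>, or zero when the
  block is too short to survive \<open>A\<^sup>i\<close>.\<close>

lemma kernel_on_range:
  "null_space_on (range (A ^^ i)) A = span (u ` {j \<in> I. i < m j})"
proof
  have "u j \<in> null_space_on (range (A ^^ i)) A" if "j \<in> I" "i < m j" for j
  proof -
    have "u j = (A ^^ i) ((A ^^ (m j - 1 - i)) (v j))"
      using that by (metis add_diff_inverse_nat comp_apply funpow_add less_Suc_eq_le
          linorder_not_le Suc_diff_1 m_pos)
    moreover have "A (u j) = (A ^^ Suc (m j - 1)) (v j)" by simp
    then have "A (u j) = 0" using top m_pos that by simp
    ultimately show ?thesis by (auto simp: null_space_on_def)
  qed
  moreover have "subspace (null_space_on (range (A ^^ i)) A)"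
  proof -
    have "null_space_on (range (A ^^ i)) A = range (A ^^ i) \<inter> {x. A x = 0}"
      by (auto simp: null_space_on_def)
    then show ?thesis
      using module_hom.subspace_image[OF hom_power subspace_UNIV]
        module_hom.subspace_kernel[OF hom_A] by (simp add: subspace_inter)
  qed
  ultimately show "span (u ` {j \<in> I. i < m j}) \<subseteq> null_space_on (range (A ^^ i)) A"
    by (intro span_minimal) auto
next
  show "null_space_on (range (A ^^ i)) A \<subseteq> span (u ` {j \<in> I. i < m j})"
  proof
    fix x assume "x \<in> null_space_on (range (A ^^ i)) A"
    then obtain y where xy: "x = (A ^^ i) y" and Ax: "A x = 0"
      by (auto simp: null_space_on_def)
    obtain w where w: "\<And>j. j \<in> I \<Longrightarrow> w j \<in> W j" and y: "y = (\<Sum>j\<in>I. w j)"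
      using direct_sum_components[OF direct] by blast
    have x: "x = (\<Sum>j\<in>I. (A ^^ i) (w j))" by (simp add: xy y power_sum)
    have "(\<Sum>j\<in>I. A ((A ^^ i) (w j))) = 0"
      using Ax by (simp add: x module_hom.sum[OF hom_A])
    moreover have "A ((A ^^ i) (w j)) \<in> W j" if "j \<in> I" for j
      using power_in_W[OF that w[OF that], of "Suc i"] by simp
    ultimately have ker: "A ((A ^^ i) (w j)) = 0" if "j \<in> I" for j
      using direct_sum_zero[OF direct, of "\<lambda>j. A ((A ^^ i) (w j))"] that by blast
    have "(A ^^ i) (w j) \<in> span (u ` {j \<in> I. i < m j})" if j: "j \<in> I" for j
    proof (cases "i < m j")
      case True
      obtain a where "(A ^^ i) (w j) = a *s u j"
        using cyclic_kernel[OF m_pos[OF j] top[OF j] last[OF j] _ ker[OF j]]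
          power_in_W[OF j w[OF j]] W_eq[OF j] by metis
      then show ?thesis using True j by (simp add: span_scale span_base)
    next
      case False
      then show ?thesis using power_annihilates_W[OF j w[OF j]] by (simp add: span_zero)
    qed
    then show "x \<in> span (u ` {j \<in> I. i < m j})" unfolding x by (rule span_sum)
  qed
qed

lemma dim_kernel_on_range:
  "dim (null_space_on (range (A ^^ i)) A) = card {j \<in> I. i < m j}"
  unfolding kernel_on_range
  using finite_I by (intro dim_span_family last_vectors_independent) auto

end

section \<open>Counting Jordan blocks\<close>

theorem mainTheorem4:
  fixes scale :: "'a::field \<Rightarrow> 'b::ab_group_add \<Rightarrow> 'b"
    and Basis :: "'b set"
    and A :: "'b \<Rightarrow> 'b"
    and n :: nat
    and d :: "nat \<Rightarrow> nat"
    and I :: "'i set"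
    and W :: "'i \<Rightarrow> 'b set"
  assumes "finite_dimensional_vector_space scale Basis"
    and "\<exists>v::'b. v \<noteq> 0"
    and "Vector_Spaces.linear scale scale A"
    and "nilpotent_map A"
    and "n = nilpotency_index A"
    and "\<And>i. i \<le> n \<Longrightarrow> d i = vector_space.dim scale (null_space_on (range (A ^^ i)) A)"
    and "cyclic_decomposition scale A I W"
  shows "\<forall>i\<in>{1..n}. int (card {j \<in> I. vector_space.dim scale (W j) = i}) = int (d (i - 1)) - int (d i)"
proof
  fix i assume i: "i \<in> {1..n}"
  interpret finite_dimensional_vector_space scale Basis by (rule assms(1))
  interpret endomorphism scale A 
    using assms(3) by (intro endomorphism.intro endomorphism_axioms.intro vector_space_axioms)
  have direct: "is_direct_sum scale I W" and cyc: "\<And>j. j \<in> I \<Longrightarrow> cyclic_subspace scale A (W j)"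
    using assms(7) by (auto simp: cyclic_decomposition_def)
  have "\<forall>j\<in>I. \<exists>p. 0 < snd p \<and> (A ^^ snd p) (fst p) = 0 \<and> (A ^^ (snd p - 1)) (fst p) \<noteq> 0
      \<and> W j = span ((\<lambda>k. (A ^^ k) (fst p)) ` {..<snd p})"
    using cyclic_subspace_obtain[OF cyc] by (metis fst_conv snd_conv)
  then obtain p where p: "\<forall>j\<in>I. 0 < snd (p j) \<and> (A ^^ snd (p j)) (fst (p j)) = 0
      \<and> (A ^^ (snd (p j) - 1)) (fst (p j)) \<noteq> 0
      \<and> W j = span ((\<lambda>k. (A ^^ k) (fst (p j))) ` {..<snd (p j)})"
    by metis
  define v m where "v = fst \<circ> p" and "m = snd \<circ> p"
  interpret cyclic_sum scale A I W v m
    using p direct by unfold_locales (auto simp: v_def m_def)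
  have d: "d k = card {j \<in> I. k < m j}" if "k \<le> n" for k
    using assms(6)[OF that] dim_kernel_on_range by simp
  have "{j \<in> I. i - 1 < m j} = {j \<in> I. m j = i} \<union> {j \<in> I. i < m j}"
    using i by auto
  then have "card {j \<in> I. i - 1 < m j} = card {j \<in> I. m j = i} + card {j \<in> I. i < m j}"
    using finite_I by (simp add: card_Un_disjoint disjoint_iff)
  moreover have "{j \<in> I. dim (W j) = i} = {j \<in> I. m j = i}"
    using dim_W by auto
  moreover have "d i = card {j \<in> I. i < m j}" and "d (i - 1) = card {j \<in> I. i - 1 < m j}"
    using i by (simp_all only: d atLeastAtMost_iff diff_le_self le_trans[of "i - 1" i])
  ultimately show "int (card {j \<in> I. dim (W j) = i}) = int (d (i - 1)) - int (d i)"
    by simp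
qed

end
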